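(* Suppose $X$ has continuous paths. Then the following assertions are equivalent: (i) $X$ does not admit a simple arbitrage. (ii) $X$ satisfies (TWC) at bounded stopping times and (NOA).
   Context: Setting: $(\Omega,\mathcal{F},(\mathcal{F}_t)_{t\in[0,\infty)},P)$ is a filtered probability space satisfying the usual conditions (completeness and right-continuity), and $X=(X_t)_{t\in[0,\infty)}$ is an $(\mathcal{F}_t)$-adapted $\mathbb{R}^D$-valued process (column vectors) modelling $D$ discounted stocks; there is also a constant bond $B_t=1$. All stopping times are with respect to $(\mathcal{F}_t)$. Simple strategy: $\Phi_t=\phi_0\mathbf{1}_{\{0\}}(t)+\sum_{j=0}^{n-1}\phi_j\mathbf{1}_{(\tau_j,\tau_{j+1}]}(t)$, where $n\in\mathbb{N}$, $0=\tau_0\le\tau_1\le\cdots\le\tau_n$ are a.s. finite stopping times and each $\phi_j$ is a $D$-dimensional row vector of $\mathcal{F}_{\tau_j}$-measurable (real) random variables. Its terminal wealth with zero initial capital is $V_\infty(\Phi;0)=\sum_{j=0}^{n-1}\phi_j(X_{\tau_{j+1}}-X_{\tau_j})$. A simple strategy $\Phi$ is a simple arbitrage if $V_\infty(\Phi;0)\ge0$ $P$-a.s. and $P(V_\infty(\Phi;0)>0)>0$. For a stopping time $\sigma$, an $\mathcal{F}_\sigma$-measurable direction is a $D$-dimensional row vector $H$ of $\mathcal{F}_\sigma$-measurable random variables with $|H|=1$ $P$-a.s. (Euclidean norm). (NOA), no obvious arbitrage: for every ($[0,\infty]$-valued) stopping time $\sigma$ with $P(\sigma<\infty)>0$, every $\varepsilon>0$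 and every $\mathcal{F}_\sigma$-measurable direction $H$, $P\big(\{\sigma<\infty\}\cap\{\sup_{t\in[\sigma,\infty)}H(X_t-X_\sigma)<\varepsilon\}\big)>0$. (TWC), two-way crossing: for an a.s. finite stopping time $\sigma$ and an $\mathcal{F}_\sigma$-measurable direction $H$ let $\sigma_H=\inf\{t\ge\sigma:\ H(X_t-X_\sigma)>0\}$ (with $\inf\emptyset=\infty$). $X$ satisfies (TWC) at bounded stopping times if $\sigma_H=\sigma_{-H}$ $P$-a.s. for every bounded stopping time $\sigma$ and every $\mathcal{F}_\sigma$-measurable direction $H$. *)

theory Defs
  imports "HOL-Probability.Probability"
begin

locale usual_filtered_prob_space = prob_space M + complete_measure M
  for M :: "'a measure" +
  fixes F :: "real \<Rightarrow> 'a measure"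
  assumes subalgebra_F: "\<And>t. 0 \<le> t \<Longrightarrow> subalgebra M (F t)"
    and F_mono: "\<And>s t. 0 \<le> s \<Longrightarrow> s \<le> t \<Longrightarrow> sets (F s) \<subseteq> sets (F t)"
    and null_sets_F0: "null_sets M \<subseteq> sets (F 0)"
    and F_right_continuous: "\<And>t. 0 \<le> t \<Longrightarrow> sets (F t) = (\<Inter>s\<in>{t<..}. sets (F s))"

text \<open>
  The library's \<^const>\<open>stopping_time\<close> uses one type for the time index and for the values of the
  stopping time.  To have \<open>[0,\<infinity>]\<close>-valued stopping times, the filtration, which only matters on
  \<open>[0,\<infinity>)\<close>, is reindexed by \<^typ>\<open>ennreal\<close>, with the full sigma-algebra at infinity.
  The two lemmas below spell out what the library notions then mean.
\<close>

definition ext_filtration :: "'a measure \<Rightarrow> (real \<Rightarrow> 'a measure) \<Rightarrow> ennreal \<Rightarrow> 'a measure" where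
  "ext_filtration M F t = (if t = \<infinity> then M else F (enn2real t))"

abbreviation stop_time :: "'a measure \<Rightarrow> (real \<Rightarrow> 'a measure) \<Rightarrow> ('a \<Rightarrow> ennreal) \<Rightarrow> bool" where
  "stop_time M F \<equiv> stopping_time (ext_filtration M F)"

abbreviation sigma_at :: "'a measure \<Rightarrow> (real \<Rightarrow> 'a measure) \<Rightarrow> ('a \<Rightarrow> ennreal) \<Rightarrow> 'a measure" where
  "sigma_at M F \<equiv> filtration.pre_sigma (space M) (ext_filtration M F)"

context usual_filtered_prob_space
begin

sublocale ext: filtration "space M" "ext_filtration M F"
proof
  show "space (ext_filtration M F i) = space M" for i
    using subalgebra_F[of "enn2real i"] by (simp add: ext_filtration_def subalgebra_def)
  show "sets (ext_filtration M F i) \<subseteq> sets (ext_filtration M F j)" if "i \<le> j" for i j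
  proof (cases "j = \<infinity>")
    case True
    then show ?thesis
      using subalgebra_F[of "enn2real i"] by (simp add: ext_filtration_def subalgebra_def)
  next
    case False
    with that have "i \<noteq> \<infinity>" "enn2real i \<le> enn2real j"
      by (auto simp: enn2real_mono less_top top_unique)
    with False show ?thesis
      using F_mono[of "enn2real i" "enn2real j"] by (simp add: ext_filtration_def)
  qed
qed

lemma all_ennreal_iff: "(\<forall>t. Q t) \<longleftrightarrow> Q (\<infinity>::ennreal) \<and> (\<forall>t\<ge>0. Q (ennreal t))"
  by (metis enn2real_nonneg ennreal_enn2real_if infinity_ennreal_def)

lemma stop_time_iff:
  "stop_time M F T \<longleftrightarrow> (\<forall>t\<ge>0. {\<omega> \<in> space M. T \<omega> \<le> ennreal t} \<in> sets (F t))"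
  unfolding stopping_time_def all_ennreal_iff
  using subalgebra_F by (auto simp: ext_filtration_def pred_def subalgebra_def)

lemma sets_sigma_at:
  assumes "stop_time M F T"
  shows "sets (sigma_at M F T) =
    {A \<in> sets M. \<forall>t\<ge>0. {\<omega> \<in> A. T \<omega> \<le> ennreal t} \<in> sets (F t)}"
  unfolding ext.sets_pre_sigma[OF assms] all_ennreal_iff by (simp add: ext_filtration_def)

end

definition adapted :: "(real \<Rightarrow> 'a measure) \<Rightarrow> (real \<Rightarrow> 'a \<Rightarrow> real ^ 'd) \<Rightarrow> bool" where
  "adapted F X \<longleftrightarrow> (\<forall>t\<ge>0. X t \<in> borel_measurable (F t))"

definition continuous_paths :: "'a measure \<Rightarrow> (real \<Rightarrow> 'a \<Rightarrow> real ^ 'd) \<Rightarrow> bool" where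
  "continuous_paths M X \<longleftrightarrow> (\<forall>\<omega>\<in>space M. continuous_on {0..} (\<lambda>t. X t \<omega>))"

text \<open>
  \<open>X\<close> sampled at a random time.  On \<open>{T = \<infinity>}\<close> the value is the junk value \<open>X\<^sub>0\<close>;
  it is used only for a.s. finite \<open>T\<close> or on \<open>{T < \<infinity>}\<close>.
\<close>

definition at_time :: "(real \<Rightarrow> 'a \<Rightarrow> real ^ 'd) \<Rightarrow> ('a \<Rightarrow> ennreal) \<Rightarrow> 'a \<Rightarrow> real ^ 'd" where
  "at_time X T \<omega> = X (enn2real (T \<omega>)) \<omega>"

definition simple_data ::
  "'a measure \<Rightarrow> (real \<Rightarrow> 'a measure) \<Rightarrow> nat \<Rightarrow> (nat \<Rightarrow> 'a \<Rightarrow> ennreal) \<Rightarrow> (nat \<Rightarrow> 'a \<Rightarrow> real ^ 'd) \<Rightarrow> bool"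
where
  "simple_data M F n \<tau> \<phi> \<longleftrightarrow>
     0 < n \<and>
     (\<forall>j\<le>n. stop_time M F (\<tau> j) \<and> (AE \<omega> in M. \<tau> j \<omega> < \<infinity>)) \<and>
     (\<forall>\<omega>\<in>space M. \<tau> 0 \<omega> = 0 \<and> (\<forall>j<n. \<tau> j \<omega> \<le> \<tau> (Suc j) \<omega>)) \<and>
     (\<forall>j<n. \<phi> j \<in> borel_measurable (sigma_at M F (\<tau> j)))"

definition simple_process ::
  "nat \<Rightarrow> (nat \<Rightarrow> 'a \<Rightarrow> ennreal) \<Rightarrow> (nat \<Rightarrow> 'a \<Rightarrow> real ^ 'd) \<Rightarrow> real \<Rightarrow> 'a \<Rightarrow> real ^ 'd"
where
  "simple_process n \<tau> \<phi> t \<omega> =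
     indicator {0} t *\<^sub>R \<phi> 0 \<omega> +
     (\<Sum>j<n. indicator {\<tau> j \<omega> <.. \<tau> (Suc j) \<omega>} (ennreal t) *\<^sub>R \<phi> j \<omega>)"

definition terminal_wealth ::
  "(real \<Rightarrow> 'a \<Rightarrow> real ^ 'd) \<Rightarrow> nat \<Rightarrow> (nat \<Rightarrow> 'a \<Rightarrow> ennreal) \<Rightarrow> (nat \<Rightarrow> 'a \<Rightarrow> real ^ 'd) \<Rightarrow> 'a \<Rightarrow> real"
where
  "terminal_wealth X n \<tau> \<phi> \<omega> =
     (\<Sum>j<n. \<phi> j \<omega> \<bullet> (at_time X (\<tau> (Suc j)) \<omega> - at_time X (\<tau> j) \<omega>))"

text \<open>
  Where all the \<open>\<tau> j\<close> are finite, the terminal wealth is the pathwise integral of the step function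
  \<open>\<Phi>\<close>, so up to null sets it does not depend on the representation \<open>(n, \<tau>, \<phi>)\<close> chosen for \<open>\<Phi>\<close>.
\<close>

definition simple_arbitrage ::
  "'a measure \<Rightarrow> (real \<Rightarrow> 'a measure) \<Rightarrow> (real \<Rightarrow> 'a \<Rightarrow> real ^ 'd) \<Rightarrow> (real \<Rightarrow> 'a \<Rightarrow> real ^ 'd) \<Rightarrow> bool"
where
  "simple_arbitrage M F X \<Phi> \<longleftrightarrow>
     (\<exists>n \<tau> \<phi>. simple_data M F n \<tau> \<phi> \<and>
        (\<forall>t\<ge>0. \<forall>\<omega>\<in>space M. \<Phi> t \<omega> = simple_process n \<tau> \<phi> t \<omega>) \<and>
        (AE \<omega> in M. terminal_wealth X n \<tau> \<phi> \<omega> \<ge> 0) \<and>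
        measure M {\<omega> \<in> space M. terminal_wealth X n \<tau> \<phi> \<omega> > 0} > 0)"

definition direction ::
  "'a measure \<Rightarrow> (real \<Rightarrow> 'a measure) \<Rightarrow> ('a \<Rightarrow> ennreal) \<Rightarrow> ('a \<Rightarrow> real ^ 'd) \<Rightarrow> bool"
where
  "direction M F \<sigma> H \<longleftrightarrow>
     H \<in> borel_measurable (sigma_at M F \<sigma>) \<and> (AE \<omega> in M. norm (H \<omega>) = 1)"

definition NOA :: "'a measure \<Rightarrow> (real \<Rightarrow> 'a measure) \<Rightarrow> (real \<Rightarrow> 'a \<Rightarrow> real ^ 'd) \<Rightarrow> bool" where
  "NOA M F X \<longleftrightarrow>
     (\<forall>\<sigma> \<epsilon> H. stop_time M F \<sigma> \<longrightarrow> measure M {\<omega> \<in> space M. \<sigma> \<omega> < \<infinity>} > 0 \<longrightarrow>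
        (0::real) < \<epsilon> \<longrightarrow> direction M F \<sigma> H \<longrightarrow>
        measure M {\<omega> \<in> space M. \<sigma> \<omega> < \<infinity> \<and>
          (SUP t\<in>{enn2real (\<sigma> \<omega>)..}. ereal (H \<omega> \<bullet> (X t \<omega> - at_time X \<sigma> \<omega>))) < ereal \<epsilon>} > 0)"

definition crossing_time ::
  "(real \<Rightarrow> 'a \<Rightarrow> real ^ 'd) \<Rightarrow> ('a \<Rightarrow> ennreal) \<Rightarrow> ('a \<Rightarrow> real ^ 'd) \<Rightarrow> 'a \<Rightarrow> ennreal"
where
  "crossing_time X \<sigma> H \<omega> =
     Inf {ennreal t | t. 0 \<le> t \<and> \<sigma> \<omega> \<le> ennreal t \<and> H \<omega> \<bullet> (X t \<omega> - at_time X \<sigma> \<omega>) > 0}"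

definition TWC_bounded :: "'a measure \<Rightarrow> (real \<Rightarrow> 'a measure) \<Rightarrow> (real \<Rightarrow> 'a \<Rightarrow> real ^ 'd) \<Rightarrow> bool" where
  "TWC_bounded M F X \<longleftrightarrow>
     (\<forall>\<sigma> H. stop_time M F \<sigma> \<longrightarrow> (\<exists>K::real. \<forall>\<omega>\<in>space M. \<sigma> \<omega> \<le> ennreal K) \<longrightarrow>
        direction M F \<sigma> H \<longrightarrow>
        (AE \<omega> in M. crossing_time X \<sigma> H \<omega> = crossing_time X \<sigma> (\<lambda>\<omega>. - H \<omega>) \<omega>))"

end

theory Submission
  imports Defs
begin

text \<open>
  If trading in a direction \<open>H\<close> from a bounded time \<open>\<sigma>\<close> on crosses zero upwards before it crosses it
  downwards, then holding \<open>H\<close> until the downward crossing, or until a fixed rational time if that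
  comes first, never loses, and it gains with positive probability for some rational; this violates
  (i). If (NOA) fails, buying \<open>H\<close> at \<open>\<sigma>\<close> and selling once a fixed gain is reached is an arbitrage.

  Conversely, given (TWC) and (NOA), induction on the number of trades reduces to a strategy with a
  single buying time \<open>\<sigma>\<close> and selling time \<open>\<tau>\<close>: where the wealth is negative before the last trade,
  that trade alone would be an arbitrage. If the path of \<open>H(X - X\<^sub>\<sigma>)\<close> reached a level \<open>-\<delta>\<close> before
  \<open>\<tau>\<close>, it would have to rise by \<open>\<delta>\<close> up to \<open>\<tau>\<close>, which (NOA) forbids. So it does not cross zero
  downwards before \<open>\<tau>\<close>, by (TWC) not upwards either, and the gain is zero.
\<close>

section \<open>Measurability of a continuous process at a random time\<close>

lemma borel_measurable_random_time:
  fixes Y :: "real \<Rightarrow> 'a \<Rightarrow> 'b::metric_space"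
  assumes Y: "\<And>t. 0 \<le> t \<Longrightarrow> Y t \<in> borel_measurable N"
    and cont: "\<And>\<omega>. \<omega> \<in> space N \<Longrightarrow> continuous_on {0..} (\<lambda>t. Y t \<omega>)"
    and T [measurable]: "T \<in> borel_measurable N"
    and T_nonneg: "\<And>\<omega>. \<omega> \<in> space N \<Longrightarrow> 0 \<le> T \<omega>"
  shows "(\<lambda>\<omega>. Y (T \<omega>) \<omega>) \<in> borel_measurable N"
proof (rule borel_measurable_LIMSEQ_metric)
  \<comment> \<open>\<open>T\<close> is rounded down to the multiples of \<open>1 / Suc n\<close>.
    The rounded time has countably many values, so sampling there is measurable value by value, and
    path continuity passes measurability to the limit.\<close>
  let ?g = "\<lambda>n \<omega>. nat \<lfloor>real (Suc n) * T \<omega>\<rfloor>"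
  show "(\<lambda>\<omega>. Y (real (?g n \<omega>) / real (Suc n)) \<omega>) \<in> borel_measurable N" for n
    by (rule measurable_compose_countable[where g = "?g n"]) (auto intro!: Y)
  fix \<omega> assume \<omega>: "\<omega> \<in> space N"
  have "(\<lambda>n. real (?g n \<omega>) / real (Suc n)) \<longlonglongrightarrow> T \<omega>"
  proof (rule tendsto_sandwich)
    have "real (Suc n) * T \<omega> - 1 \<le> real (?g n \<omega>)" "real (?g n \<omega>) \<le> real (Suc n) * T \<omega>" for n
      by linarith (simp add: T_nonneg[OF \<omega>] of_nat_floor del: of_nat_Suc)
    then have "(real (Suc n) * T \<omega> - 1) / real (Suc n) \<le> real (?g n \<omega>) / real (Suc n)"
      "real (?g n \<omega>) / real (Suc n) \<le> real (Suc n) * T \<omega> / real (Suc n)" for n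
      by (intro divide_right_mono; simp del: of_nat_Suc)+
    then show "\<forall>\<^sub>F n in sequentially. T \<omega> - 1 / real (Suc n) \<le> real (?g n \<omega>) / real (Suc n)"
      "\<forall>\<^sub>F n in sequentially. real (?g n \<omega>) / real (Suc n) \<le> T \<omega>"
      by (simp_all add: diff_divide_distrib del: of_nat_Suc)
    show "(\<lambda>n. T \<omega> - 1 / real (Suc n)) \<longlonglongrightarrow> T \<omega>"
      using tendsto_diff[OF tendsto_const LIMSEQ_inverse_real_of_nat, of "T \<omega>"]
      by (simp add: divide_inverse)
  qed simp
  from continuous_on_tendsto_compose[OF cont[OF \<omega>] this] T_nonneg[OF \<omega>]
  show "(\<lambda>n. Y (real (?g n \<omega>) / real (Suc n)) \<omega>) \<longlonglongrightarrow> Y (T \<omega>) \<omega>"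
    by (simp del: of_nat_Suc)
qed

section \<open>Stopping times and their sigma-algebras\<close>

context usual_filtered_prob_space
begin

lemma ext_filtration_ennreal: "0 \<le> t \<Longrightarrow> ext_filtration M F (ennreal t) = F t"
  by (simp add: ext_filtration_def)

lemma space_F: "0 \<le> t \<Longrightarrow> space (F t) = space M"
  using subalgebra_F by (auto simp: subalgebra_def)

lemma sets_F_subset: "0 \<le> t \<Longrightarrow> sets (F t) \<subseteq> sets M"
  using subalgebra_F by (auto simp: subalgebra_def)

lemma space_sigma_at: "space (sigma_at M F T) = space M"
  by (rule ext.space_pre_sigma)

lemma subalgebra_sigma_at: "stop_time M F T \<Longrightarrow> subalgebra M (sigma_at M F T)"
  by (auto simp: subalgebra_def space_sigma_at sets_sigma_at)

lemma sigma_at_measurable_M: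
  "stop_time M F T \<Longrightarrow> f \<in> sigma_at M F T \<rightarrow>\<^sub>M N \<Longrightarrow> f \<in> M \<rightarrow>\<^sub>M N"
  using measurable_from_subalg[OF subalgebra_sigma_at] by blast

lemma stop_time_measurable_M: "stop_time M F T \<Longrightarrow> T \<in> borel_measurable M"
  using ext.measurable_stopping_time_pre_sigma sigma_at_measurable_M by blast

lemma sigma_at_mono:
  assumes "stop_time M F S" "stop_time M F T" "\<And>\<omega>. \<omega> \<in> space M \<Longrightarrow> S \<omega> \<le> T \<omega>"
    "f \<in> sigma_at M F S \<rightarrow>\<^sub>M N"
  shows "f \<in> sigma_at M F T \<rightarrow>\<^sub>M N"
  using measurable_from_subalg[of "sigma_at M F T" "sigma_at M F S" f N]
    ext.mono_pre_sigma[of S T] assms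
  by (simp add: subalgebra_def space_sigma_at)

lemma pred_sigma_atD:
  assumes "stop_time M F T" "Measurable.pred (sigma_at M F T) P" "0 \<le> t"
  shows "Measurable.pred (F t) (\<lambda>\<omega>. P \<omega> \<and> T \<omega> \<le> ennreal t)"
  using ext.sets_pre_sigmaD[OF assms(1), of "{\<omega> \<in> space M. P \<omega>}" "ennreal t"] assms(2,3)
  by (simp add: pred_def space_sigma_at space_F ext_filtration_ennreal)

lemma pred_F_mono:
  "0 \<le> s \<Longrightarrow> s \<le> t \<Longrightarrow> Measurable.pred (F s) P \<Longrightarrow> Measurable.pred (F t) P"
  using F_mono by (auto simp: pred_def space_F)

text \<open>This allows a bounded time to replace \<open>T\<close>. An event known at
  \<open>T\<close>, cut down to \<open>T \<le> K\<close>, is known at \<open>min T K\<close>: its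
  part up to time \<open>t\<close> is its part on \<open>T \<le> min t K\<close>. The target space
  \<open>N\<close> is arbitrary so that positions, levels and predicates can all be cut off.\<close>

lemma measurable_truncated:
  assumes T: "stop_time M F T" and f: "f \<in> sigma_at M F T \<rightarrow>\<^sub>M N" and c: "c \<in> space N"
    and K: "0 \<le> K"
  shows "(\<lambda>\<omega>. if T \<omega> \<le> ennreal K then f \<omega> else c) \<in> sigma_at M F (\<lambda>\<omega>. min (T \<omega>) (ennreal K)) \<rightarrow>\<^sub>M N"
    (is "?f \<in> ?G \<rightarrow>\<^sub>M N")
proof -
  have min: "stop_time M F (\<lambda>\<omega>. min (T \<omega>) (ennreal K))"
    using T by (intro stopping_time_min stopping_time_const)
  have *: "{\<omega> \<in> space M. P \<omega> \<and> T \<omega> \<le> ennreal K} \<in> sets ?G"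
    if P: "Measurable.pred (sigma_at M F T) P" for P
    unfolding sets_sigma_at[OF min]
  proof (intro CollectI conjI allI impI)
    show "{\<omega> \<in> space M. P \<omega> \<and> T \<omega> \<le> ennreal K} \<in> events"
      using pred_sigma_atD[OF T P K] sets_F_subset[OF K] by (auto simp: pred_def space_F K)
    fix t :: real assume t: "0 \<le> t"
    have "Measurable.pred (F t) (\<lambda>\<omega>. P \<omega> \<and> T \<omega> \<le> ennreal (min t K))"
      using t K by (intro pred_F_mono[OF _ _ pred_sigma_atD[OF T P]]) auto
    moreover have "{\<omega> \<in> {\<omega> \<in> space M. P \<omega> \<and> T \<omega> \<le> ennreal K}. min (T \<omega>) (ennreal K) \<le> ennreal t} =
      {\<omega> \<in> space M. P \<omega> \<and> T \<omega> \<le> ennreal (min t K)}"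
      by (auto simp: min_def not_le dest: order_trans intro: order_trans[OF _ ennreal_leI])
    ultimately show "{\<omega> \<in> {\<omega> \<in> space M. P \<omega> \<and> T \<omega> \<le> ennreal K}. min (T \<omega>) (ennreal K) \<le> ennreal t}
        \<in> sets (F t)"
      using t by (simp add: pred_def space_F)
  qed
  show ?thesis
  proof (rule measurableI)
    fix A assume A [measurable]: "A \<in> sets N"
    have "{\<omega> \<in> space M. f \<omega> \<in> A \<and> T \<omega> \<le> ennreal K} \<in> sets ?G"
      by (rule *) (use f in measurable)
    moreover have "{\<omega> \<in> space M. c \<in> A} - {\<omega> \<in> space M. True \<and> T \<omega> \<le> ennreal K} \<in> sets ?G"
    proof (rule sets.Diff)
      show "{\<omega> \<in> space M. c \<in> A} \<in> sets ?G"
        by (metis sets.sets_Collect_const space_sigma_at)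
      show "{\<omega> \<in> space M. True \<and> T \<omega> \<le> ennreal K} \<in> sets ?G"
        by (rule *) simp
    qed
    ultimately have "{\<omega> \<in> space M. f \<omega> \<in> A \<and> T \<omega> \<le> ennreal K} \<union>
        ({\<omega> \<in> space M. c \<in> A} - {\<omega> \<in> space M. True \<and> T \<omega> \<le> ennreal K}) \<in> sets ?G"
      by (rule sets.Un)
    also have "{\<omega> \<in> space M. f \<omega> \<in> A \<and> T \<omega> \<le> ennreal K} \<union>
        ({\<omega> \<in> space M. c \<in> A} - {\<omega> \<in> space M. True \<and> T \<omega> \<le> ennreal K}) = ?f -` A \<inter> space ?G"
      by (auto simp: space_sigma_at split: if_splits)
    finally show "?f -` A \<inter> space ?G \<in> sets ?G" .
  next
    fix \<omega> assume "\<omega> \<in> space ?G"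
    then show "?f \<omega> \<in> space N"
      using measurable_space[OF f] c by (simp add: space_sigma_at)
  qed
qed

text \<open>Here right-continuity of the filtration enters. For each \<open>s > t\<close> the event
  \<open>T \<le> t\<close> is the intersection of the events \<open>T < r\<close> over rational
  \<open>r\<close> in \<open>(t, s]\<close>, hence lies in \<open>F s\<close>; all
  \<open>s > t\<close> together give \<open>F t\<close>.\<close>

lemma stop_timeI_less:
  assumes "\<And>t. 0 \<le> t \<Longrightarrow> Measurable.pred (F t) (\<lambda>\<omega>. T \<omega> < ennreal t)"
  shows "stop_time M F T"
  unfolding stop_time_iff
proof (intro allI impI)
  fix t :: real assume t: "0 \<le> t"
  have "{\<omega> \<in> space M. T \<omega> \<le> ennreal t} \<in> sets (F s)" if s: "t < s" for s
  proof -
    have "T \<omega> \<le> ennreal t \<longleftrightarrow> (\<forall>r\<in>{r\<in>\<rat>. t < r \<and> r \<le> s}. T \<omega> < ennreal r)" for \<omega>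
    proof
      assume *: "\<forall>r\<in>{r\<in>\<rat>. t < r \<and> r \<le> s}. T \<omega> < ennreal r"
      show "T \<omega> \<le> ennreal t"
      proof (rule ccontr)
        assume "\<not> T \<omega> \<le> ennreal t"
        then have "ennreal t < min (T \<omega>) (ennreal s)"
          using s t by (simp add: ennreal_lessI)
        then obtain u where u: "ennreal t < u" "u < min (T \<omega>) (ennreal s)"
          using dense by blast
        then obtain v where v: "0 \<le> v" "u = ennreal v"
          by (cases u) auto
        obtain r where r: "r \<in> \<rat>" "t < r" "r < v"
          using Rats_dense_in_real[of t v] u v t by (auto simp: ennreal_less_iff)
        then have "T \<omega> < ennreal r"
          using * u v t by (auto simp: ennreal_less_iff)
        also have "\<dots> \<le> u"
          using r v by (simp add: ennreal_leI)
        finally show False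
          using u by auto
      qed
    next
      assume "T \<omega> \<le> ennreal t"
      then show "\<forall>r\<in>{r\<in>\<rat>. t < r \<and> r \<le> s}. T \<omega> < ennreal r"
        using t by (auto intro: le_less_trans simp: ennreal_lessI)
    qed
    moreover have "Measurable.pred (F s) (\<lambda>\<omega>. \<forall>r\<in>{r\<in>\<rat>. t < r \<and> r \<le> s}. T \<omega> < ennreal r)"
      using t by (intro measurable_pred_countable countable_Collect countable_rat
          pred_F_mono[OF _ _ assms]) auto
    ultimately show ?thesis
      using s t by (simp add: pred_def space_F)
  qed
  then show "{\<omega> \<in> space M. T \<omega> \<le> ennreal t} \<in> sets (F t)"
    unfolding F_right_continuous[OF t] by auto
qed

lemma measurable_min_stop_time:
  assumes T: "stop_time M F T" and t: "0 \<le> t"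
  shows "(\<lambda>\<omega>. min (T \<omega>) (ennreal t)) \<in> borel_measurable (F t)"
proof (rule borel_measurableI_le)
  fix s
  show "{\<omega> \<in> space (F t). min (T \<omega>) (ennreal t) \<le> s} \<in> sets (F t)"
  proof (cases "s \<le> ennreal t")
    case True
    from ext.stopping_time_le_const[OF T True] have "Measurable.pred (F t) (\<lambda>\<omega>. T \<omega> \<le> s)"
      using t by (simp add: ext_filtration_ennreal)
    then show ?thesis
      using True unfolding min_le_iff_disj by (cases "s = ennreal t") (auto simp: pred_def)
  next
    case False
    then show ?thesis
      by (simp add: min_le_iff_disj not_le less_imp_le)
  qed
qed

end

section \<open>The price process sampled at stopping times\<close>

locale continuous_market = usual_filtered_prob_space M F
  for M :: "'a measure" and F :: "real \<Rightarrow> 'a measure" +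
  fixes X :: "real \<Rightarrow> 'a \<Rightarrow> real ^ 'd"
  assumes X: "adapted F X" "continuous_paths M X"
begin

lemma measurable_stopped:
  assumes T: "stop_time M F T" and t: "0 \<le> t"
  shows "at_time X (\<lambda>\<omega>. min (T \<omega>) (ennreal t)) \<in> borel_measurable (F t)"
proof -
  let ?T = "\<lambda>\<omega>. min (T \<omega>) (ennreal t)"
  have "enn2real (?T \<omega>) \<le> t" for \<omega>
    using t by (metis enn2real_ennreal enn2real_mono ennreal_less_top min.cobounded2)
  then have "at_time X ?T = (\<lambda>\<omega>. X (min (enn2real (?T \<omega>)) t) \<omega>)"
    by (auto simp: at_time_def fun_eq_iff min_absorb1)
  moreover have "(\<lambda>\<omega>. X (min (enn2real (?T \<omega>)) t) \<omega>) \<in> borel_measurable (F t)"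
  \<comment> \<open>Freezing the paths at \<open>t\<close> makes every \<open>Y s\<close> measurable
    for \<open>F t\<close> and keeps the paths continuous.\<close>
  proof (rule borel_measurable_random_time[where Y = "\<lambda>s. X (min s t)"])
    show "X (min s t) \<in> borel_measurable (F t)" if "0 \<le> s" for s
    proof (rule measurable_from_subalg[of "F t" "F (min s t)"])
      show "subalgebra (F t) (F (min s t))"
        using that t F_mono[of "min s t" t] by (simp add: subalgebra_def space_F)
      show "X (min s t) \<in> borel_measurable (F (min s t))"
        using X(1) that t by (simp add: adapted_def)
    qed
    show "continuous_on {0..} (\<lambda>s. X (min s t) \<omega>)" if "\<omega> \<in> space (F t)" for \<omega>
    proof (rule continuous_on_compose2[of "{0..}" "\<lambda>s. X s \<omega>"])
      show "continuous_on {0..} (\<lambda>s. X s \<omega>)"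
        using X(2) that t by (simp add: continuous_paths_def space_F)
      show "continuous_on {0..} (\<lambda>s. min s t)"
        by (intro continuous_intros)
    qed (use t in auto)
    show "(\<lambda>\<omega>. enn2real (?T \<omega>)) \<in> borel_measurable (F t)"
      using measurable_min_stop_time[OF T t] by measurable
  qed auto
  ultimately show ?thesis by simp
qed

text \<open>On \<open>T \<le> t\<close> the value at \<open>T\<close> is the value at
  \<open>min T t\<close>, which is known at \<open>t\<close> by \<open>measurable_stopped\<close>.
  Membership in \<open>sets M\<close> is shown separately and includes the points where
  \<open>T\<close> is infinite and the default value \<open>X 0\<close> is read.\<close>

lemma measurable_at_time:
  assumes T: "stop_time M F T"
  shows "at_time X T \<in> borel_measurable (sigma_at M F T)"
proof (rule measurableI)
  fix A :: "(real^'d) set" assume A [measurable]: "A \<in> sets borel"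
  have [measurable]: "(\<lambda>\<omega>. X (enn2real (T \<omega>)) \<omega>) \<in> borel_measurable M"
  proof (rule borel_measurable_random_time[where Y = X])
    show "X t \<in> borel_measurable M" if "0 \<le> t" for t
      using X(1) that measurable_from_subalg[OF subalgebra_F] by (auto simp: adapted_def)
    show "continuous_on {0..} (\<lambda>t. X t \<omega>)" if "\<omega> \<in> space M" for \<omega>
      using X(2) that by (simp add: continuous_paths_def)
    show "(\<lambda>\<omega>. enn2real (T \<omega>)) \<in> borel_measurable M"
      using stop_time_measurable_M[OF T] by measurable
  qed simp
  have "{\<omega> \<in> at_time X T -` A \<inter> space M. T \<omega> \<le> ennreal t} \<in> sets (F t)" if t: "0 \<le> t" for t
  proof -
    note [measurable] = measurable_stopped[OF T t]
    have "Measurable.pred (F t) (\<lambda>\<omega>. T \<omega> \<le> ennreal t)"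
      using ext.stopping_time_le_const[OF T order_refl, of "ennreal t"] t
      by (simp add: ext_filtration_ennreal)
    then have "{\<omega> \<in> space (F t). at_time X (\<lambda>\<omega>. min (T \<omega>) (ennreal t)) \<omega> \<in> A \<and> T \<omega> \<le> ennreal t}
        \<in> sets (F t)"
      by measurable
    also have "{\<omega> \<in> space (F t). at_time X (\<lambda>\<omega>. min (T \<omega>) (ennreal t)) \<omega> \<in> A \<and> T \<omega> \<le> ennreal t} =
        {\<omega> \<in> at_time X T -` A \<inter> space M. T \<omega> \<le> ennreal t}"
      using t by (auto simp: at_time_def space_F min_absorb1)
    finally show ?thesis .
  qed
  moreover have "at_time X T -` A \<inter> space M \<in> sets M"
    unfolding at_time_def by measurable
  ultimately show "at_time X T -` A \<inter> space (sigma_at M F T) \<in> sets (sigma_at M F T)"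
    by (simp add: sets_sigma_at[OF T] space_sigma_at)
qed simp

end

section \<open>Hitting times of levels by the increments of \<open>X\<close> in a direction\<close>

lemma ennreal_less_obtain:
  assumes "0 \<le> t" "ennreal t < x"
  obtains u where "t < u" "ennreal u < x"
proof -
  obtain y where y: "ennreal t < y" "y < x"
    using dense[OF assms(2)] by blast
  then obtain u where "0 \<le> u" "y = ennreal u"
    by (cases y) auto
  then show thesis
    using y assms(1) that[of u] by (auto simp: ennreal_less_iff)
qed

text \<open>The level may depend on \<open>\<omega>\<close> because the proof of (NOA) uses one
  level where the buying time is small and another where it is large. With \<open>- H\<close> in
  place of \<open>H\<close>, a level \<open>\<delta>\<close> detects a drop by more than
  \<open>\<delta>\<close>.\<close>

definition hitting_time ::
  "(real \<Rightarrow> 'a \<Rightarrow> real ^ 'd) \<Rightarrow> ('a \<Rightarrow> ennreal) \<Rightarrow> ('a \<Rightarrow> real ^ 'd) \<Rightarrow> ('a \<Rightarrow> real) \<Rightarrow> 'a \<Rightarrow> ennreal"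
where
  "hitting_time X \<sigma> H c \<omega> =
     Inf {ennreal t | t. 0 \<le> t \<and> \<sigma> \<omega> \<le> ennreal t \<and> H \<omega> \<bullet> (X t \<omega> - at_time X \<sigma> \<omega>) > c \<omega>}"

lemma crossing_time_eq_hitting_time: "crossing_time X \<sigma> H = hitting_time X \<sigma> H (\<lambda>_. 0)"
  by (simp add: fun_eq_iff crossing_time_def hitting_time_def)

lemma hitting_time_ge: "\<sigma> \<omega> \<le> hitting_time X \<sigma> H c \<omega>"
  unfolding hitting_time_def by (rule Inf_greatest) auto

lemma hitting_time_le:
  "0 \<le> t \<Longrightarrow> \<sigma> \<omega> \<le> ennreal t \<Longrightarrow> c \<omega> < H \<omega> \<bullet> (X t \<omega> - at_time X \<sigma> \<omega>) \<Longrightarrow>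
    hitting_time X \<sigma> H c \<omega> \<le> ennreal t"
  unfolding hitting_time_def by (rule Inf_lower) auto

lemma hitting_time_lessE:
  assumes "hitting_time X \<sigma> H c \<omega> < x"
  obtains t where "0 \<le> t" "\<sigma> \<omega> \<le> ennreal t" "ennreal t < x"
    "c \<omega> < H \<omega> \<bullet> (X t \<omega> - at_time X \<sigma> \<omega>)"
  using assms unfolding hitting_time_def Inf_less_iff by auto

lemma before_hitting_time:
  "0 \<le> t \<Longrightarrow> \<sigma> \<omega> \<le> ennreal t \<Longrightarrow> ennreal t < hitting_time X \<sigma> H c \<omega> \<Longrightarrow>
    H \<omega> \<bullet> (X t \<omega> - at_time X \<sigma> \<omega>) \<le> c \<omega>"
  using hitting_time_le[of t \<sigma> \<omega> c H X] by (meson not_le)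

context continuous_market
begin

lemma path_greater_near:
  assumes "\<omega> \<in> space M" "0 \<le> t" "r < h \<bullet> (X t \<omega> - x)"
  obtains d where "0 < d" "\<And>u. 0 \<le> u \<Longrightarrow> \<bar>u - t\<bar> < d \<Longrightarrow> r < h \<bullet> (X u \<omega> - x)"
proof -
  have "continuous_on {0..} (\<lambda>t. h \<bullet> (X t \<omega> - x))"
    using X(2) assms(1) by (intro continuous_intros) (simp add: continuous_paths_def)
  then have "\<exists>d>0. \<forall>u\<in>{0..}. dist u t < d \<longrightarrow>
      dist (h \<bullet> (X u \<omega> - x)) (h \<bullet> (X t \<omega> - x)) < h \<bullet> (X t \<omega> - x) - r"
    using assms unfolding continuous_on_iff by (meson atLeast_iff diff_gt_0_iff_gt)
  then obtain d where d: "d > 0" "\<And>u. 0 \<le> u \<Longrightarrow> \<bar>u - t\<bar> < d \<Longrightarrow>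
      \<bar>h \<bullet> (X u \<omega> - x) - h \<bullet> (X t \<omega> - x)\<bar> < h \<bullet> (X t \<omega> - x) - r"
    by (auto simp: dist_real_def)
  show thesis
  proof (rule that[OF d(1)])
    fix u assume "0 \<le> u" "\<bar>u - t\<bar> < d"
    from d(2)[OF this] show "r < h \<bullet> (X u \<omega> - x)"
      by linarith
  qed
qed

text \<open>Exceeding the level is an open condition in time, so the time can be moved to a rational
  one: to the right, which keeps it after \<open>\<sigma>\<close>, and by so little that it stays
  below \<open>x\<close>.\<close>

lemma hitting_time_less_ratE:
  assumes "\<omega> \<in> space M" "hitting_time X \<sigma> H c \<omega> < x"
  obtains q where "q \<in> \<rat>" "0 \<le> q" "\<sigma> \<omega> \<le> ennreal q" "ennreal q < x"
    "c \<omega> < H \<omega> \<bullet> (X q \<omega> - at_time X \<sigma> \<omega>)"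
proof -
  from assms(2) obtain t where t: "0 \<le> t" "\<sigma> \<omega> \<le> ennreal t" "ennreal t < x"
    "c \<omega> < H \<omega> \<bullet> (X t \<omega> - at_time X \<sigma> \<omega>)"
    by (rule hitting_time_lessE)
  obtain d where d: "0 < d" "\<And>u. 0 \<le> u \<Longrightarrow> \<bar>u - t\<bar> < d \<Longrightarrow> c \<omega> < H \<omega> \<bullet> (X u \<omega> - at_time X \<sigma> \<omega>)"
    using path_greater_near[OF assms(1) t(1,4)] by blast
  obtain u where u: "t < u" "ennreal u < x"
    using ennreal_less_obtain[OF t(1,3)] by blast
  obtain q where q: "q \<in> \<rat>" "t < q" "q < min u (t + d)"
    using Rats_dense_in_real[of t "min u (t + d)"] u d by auto
  show thesis
  proof (rule that[OF q(1)])
    show "\<sigma> \<omega> \<le> ennreal q"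
      using t(2) q(2) by (meson ennreal_leI less_imp_le order_trans)
    show "ennreal q < x"
      using u(2) q(3) by (meson ennreal_leI less_imp_le min_less_iff_conj order_le_less_trans)
    show "c \<omega> < H \<omega> \<bullet> (X q \<omega> - at_time X \<sigma> \<omega>)"
      using q t(1) by (intro d(2)) auto
  qed (use q t in auto)
qed

text \<open>If the increment were below the level at the hitting time, it would be so on a whole
  neighbourhood, and the infimum would be larger. The inequality is strict for a negative level,
  which is exceeded already at \<open>\<sigma>\<close>, where the increment is 0.\<close>

lemma at_hitting_time:
  assumes \<omega>: "\<omega> \<in> space M" and fin: "hitting_time X \<sigma> H c \<omega> < \<infinity>"
  shows "c \<omega> \<le> H \<omega> \<bullet> (at_time X (hitting_time X \<sigma> H c) \<omega> - at_time X \<sigma> \<omega>)"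
proof (rule ccontr)
  define T where "T = enn2real (hitting_time X \<sigma> H c \<omega>)"
  have T: "0 \<le> T" "hitting_time X \<sigma> H c \<omega> = ennreal T"
    using fin by (auto simp: T_def)
  assume "\<not> ?thesis"
  then have "- c \<omega> < (- H \<omega>) \<bullet> (X T \<omega> - at_time X \<sigma> \<omega>)"
    by (simp add: at_time_def T_def)
  then obtain d where d: "0 < d"
    "\<And>u. 0 \<le> u \<Longrightarrow> \<bar>u - T\<bar> < d \<Longrightarrow> - c \<omega> < (- H \<omega>) \<bullet> (X u \<omega> - at_time X \<sigma> \<omega>)"
    using path_greater_near[OF \<omega> T(1)] by blast
  have "hitting_time X \<sigma> H c \<omega> < ennreal (T + d)"
    using T d by (simp add: ennreal_less_iff)
  then obtain t where t: "0 \<le> t" "\<sigma> \<omega> \<le> ennreal t" "ennreal t < ennreal (T + d)"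
    "c \<omega> < H \<omega> \<bullet> (X t \<omega> - at_time X \<sigma> \<omega>)"
    by (rule hitting_time_lessE)
  have "hitting_time X \<sigma> H c \<omega> \<le> ennreal t"
    using t by (intro hitting_time_le)
  then have "T \<le> t"
    using t(1) by (simp add: T(2))
  moreover have "t < T + d"
    using t(1,3) by (simp add: ennreal_less_iff)
  ultimately show False
    using d(2)[of t] t(1,4) by simp
qed

text \<open>The hitting time itself is included, since the increment at \<open>t\<close> is a limit
  from the left of values before it. The sign of \<open>c\<close> settles the case
  \<open>t = \<sigma>\<close>, where the increment is 0 and there is nothing to the left.\<close>

lemma upto_hitting_time:
  assumes \<omega>: "\<omega> \<in> space M" and t: "0 \<le> t" "\<sigma> \<omega> \<le> ennreal t" "ennreal t \<le> hitting_time X \<sigma> H c \<omega>"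
    and c: "0 \<le> c \<omega>"
  shows "H \<omega> \<bullet> (X t \<omega> - at_time X \<sigma> \<omega>) \<le> c \<omega>"
proof (cases "\<sigma> \<omega> = ennreal t")
  case True
  then show ?thesis
    using t(1) c by (simp add: at_time_def)
next
  case False
  define s where "s = enn2real (\<sigma> \<omega>)"
  have s: "0 \<le> s" "\<sigma> \<omega> = ennreal s"
    using le_less_trans[OF t(2) ennreal_less_top] by (simp_all add: s_def)
  then have "s < t"
    using False t by (metis ennreal_leI ennreal_le_iff not_le order_antisym)
  show ?thesis
  proof (rule ccontr)
    assume "\<not> ?thesis"
    then have "c \<omega> < H \<omega> \<bullet> (X t \<omega> - at_time X \<sigma> \<omega>)"
      by simp
    then obtain d where d: "0 < d"
      "\<And>u. 0 \<le> u \<Longrightarrow> \<bar>u - t\<bar> < d \<Longrightarrow> c \<omega> < H \<omega> \<bullet> (X u \<omega> - at_time X \<sigma> \<omega>)"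
      using path_greater_near[OF \<omega> t(1)] by blast
    obtain u where u: "max s (t - d) < u" "u < t"
      using dense[of "max s (t - d)" t] \<open>s < t\<close> d(1) by auto
    have "ennreal u < hitting_time X \<sigma> H c \<omega>"
      using t(1,3) u s(1) by (intro less_le_trans[OF _ t(3)]) (simp add: ennreal_less_iff)
    then have "H \<omega> \<bullet> (X u \<omega> - at_time X \<sigma> \<omega>) \<le> c \<omega>"
      using u s by (intro before_hitting_time) (auto intro: ennreal_leI)
    with d(2)[of u] u s(1) show False
      by auto
  qed
qed

text \<open>By continuity the level is exceeded before \<open>s\<close> exactly if it is exceeded at
  some rational \<open>q < s\<close>, and each of these countably many events is known at
  \<open>q\<close>. The resulting strict events suffice by \<open>stop_timeI_less\<close>.\<close>

lemma stop_time_hitting_time: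
  assumes T: "stop_time M F T" and H: "H \<in> borel_measurable (sigma_at M F T)"
    and c: "c \<in> borel_measurable (sigma_at M F T)"
  shows "stop_time M F (hitting_time X T H c)"
proof (rule stop_timeI_less)
  fix s :: real assume s: "0 \<le> s"
  have *: "Measurable.pred (F q) (\<lambda>\<omega>. T \<omega> \<le> ennreal q \<and> c \<omega> < H \<omega> \<bullet> (X q \<omega> - at_time X T \<omega>))"
    if q: "0 \<le> q" for q
  proof -
    \<comment> \<open>\<open>H\<close>, \<open>c\<close> and the value of \<open>X\<close> at
      \<open>T\<close> are known at \<open>T\<close>. Cut off to \<open>T \<le> q\<close> they are
      known at \<open>min T q\<close>, hence at \<open>q\<close>.\<close>
    have cut: "(\<lambda>\<omega>. if T \<omega> \<le> ennreal q then f \<omega> else y) \<in> borel_measurable (F q)"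
      if "f \<in> borel_measurable (sigma_at M F T)" for f :: "'a \<Rightarrow> 'b::topological_space" and y
    proof -
      have "subalgebra (F q) (sigma_at M F (\<lambda>\<omega>. min (T \<omega>) (ennreal q)))"
        unfolding subalgebra_def space_sigma_at space_F[OF q]
      proof safe
        fix A assume A: "A \<in> sets (sigma_at M F (\<lambda>\<omega>. min (T \<omega>) (ennreal q)))"
        from ext.sets_pre_sigmaD[OF stopping_time_min[OF T stopping_time_const] this, of "ennreal q"]
        show "A \<in> sets (F q)"
          using q by (simp add: ext_filtration_ennreal)
      qed
      from measurable_from_subalg[OF this measurable_truncated[OF T that _ q]] show ?thesis
        by simp
    qed
    have [measurable]: "X q \<in> borel_measurable (F q)"
      using X(1) q by (simp add: adapted_def)
    note [measurable] = cut[OF H, of 0] cut[OF c, of 0] cut[OF measurable_at_time[OF T], of 0]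
    have [measurable]: "Measurable.pred (F q) (\<lambda>\<omega>. T \<omega> \<le> ennreal q)"
      using ext.stopping_time_le_const[OF T order_refl, of "ennreal q"] q
      by (simp add: ext_filtration_ennreal)
    \<comment> \<open>Under the first conjunct every cut-off variable equals the original
      one.\<close>
    have "Measurable.pred (F q) (\<lambda>\<omega>. T \<omega> \<le> ennreal q \<and>
      (if T \<omega> \<le> ennreal q then c \<omega> else 0) <
      (if T \<omega> \<le> ennreal q then H \<omega> else 0) \<bullet> (X q \<omega> - (if T \<omega> \<le> ennreal q then at_time X T \<omega> else 0)))"
      by measurable
    then show ?thesis
      by (rule measurable_cong[THEN iffD1, rotated]) auto
  qed
  have "Measurable.pred (F s) (\<lambda>\<omega>. \<exists>q\<in>{q\<in>\<rat>. 0 \<le> q \<and> q < s}.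
      T \<omega> \<le> ennreal q \<and> c \<omega> < H \<omega> \<bullet> (X q \<omega> - at_time X T \<omega>))"
    by (intro measurable_pred_countable countable_Collect countable_rat pred_F_mono[OF _ _ *]) auto
  then show "Measurable.pred (F s) (\<lambda>\<omega>. hitting_time X T H c \<omega> < ennreal s)"
  proof (rule measurable_cong[THEN iffD1, rotated])
    fix \<omega> assume "\<omega> \<in> space (F s)"
    then have \<omega>: "\<omega> \<in> space M"
      using s by (simp add: space_F)
    show "(\<exists>q\<in>{q\<in>\<rat>. 0 \<le> q \<and> q < s}. T \<omega> \<le> ennreal q \<and> c \<omega> < H \<omega> \<bullet> (X q \<omega> - at_time X T \<omega>)) \<longleftrightarrow>
      hitting_time X T H c \<omega> < ennreal s"
    proof safe
      fix q assume "0 \<le> q" "q < s" "T \<omega> \<le> ennreal q" "c \<omega> < H \<omega> \<bullet> (X q \<omega> - at_time X T \<omega>)"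
      then have "hitting_time X T H c \<omega> \<le> ennreal q"
        by (intro hitting_time_le)
      also have "\<dots> < ennreal s"
        using \<open>0 \<le> q\<close> \<open>q < s\<close> by (simp add: ennreal_less_iff)
      finally show "hitting_time X T H c \<omega> < ennreal s" .
    next
      assume "hitting_time X T H c \<omega> < ennreal s"
      from hitting_time_less_ratE[OF \<omega> this]
      show "\<exists>q\<in>{q\<in>\<rat>. 0 \<le> q \<and> q < s}. T \<omega> \<le> ennreal q \<and> c \<omega> < H \<omega> \<bullet> (X q \<omega> - at_time X T \<omega>)"
        by (metis (mono_tags, lifting) ennreal_less_iff mem_Collect_eq)
    qed
  qed
qed

section \<open>No arbitrage implies (TWC) and (NOA)\<close>

abbreviation gain :: "('a \<Rightarrow> real^'d) \<Rightarrow> ('a \<Rightarrow> ennreal) \<Rightarrow> ('a \<Rightarrow> ennreal) \<Rightarrow> 'a \<Rightarrow> real" where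
  "gain \<phi> S T \<omega> \<equiv> \<phi> \<omega> \<bullet> (at_time X T \<omega> - at_time X S \<omega>)"

definition no_arbitrage :: bool where
  "no_arbitrage \<longleftrightarrow> (\<forall>\<Phi>. \<not> simple_arbitrage M F X \<Phi>)"

lemma gain_measurable_M:
  assumes S: "stop_time M F S" and T: "stop_time M F T"
    and \<phi>: "\<phi> \<in> borel_measurable (sigma_at M F S)"
  shows "gain \<phi> S T \<in> borel_measurable M"
  using sigma_at_measurable_M[OF S \<phi>] sigma_at_measurable_M[OF S measurable_at_time[OF S]]
    sigma_at_measurable_M[OF T measurable_at_time[OF T]] by measurable

text \<open>The form in which the absence of arbitrage is applied below: a single lossless trade is
  a simple strategy, so it cannot gain with positive probability.\<close>

lemma no_arbitrage_gain_eq_0: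
  assumes na: no_arbitrage
    and S: "stop_time M F S" and T: "stop_time M F T"
    and le: "\<And>\<omega>. \<omega> \<in> space M \<Longrightarrow> S \<omega> \<le> T \<omega>" and fin: "AE \<omega> in M. T \<omega> < \<infinity>"
    and \<phi>: "\<phi> \<in> borel_measurable (sigma_at M F S)"
    and nonneg: "AE \<omega> in M. 0 \<le> gain \<phi> S T \<omega>"
  shows "AE \<omega> in M. gain \<phi> S T \<omega> = 0"
proof -
  \<comment> \<open>A simple strategy has to start at time 0, so a period from 0 to \<open>S\<close>
    with zero position is put in front of the trade.\<close>
  define \<tau> where "\<tau> j = (if j = 0 then \<lambda>_. 0 else if j = 1 then S else T)" for j :: nat
  define \<psi> where "\<psi> j = (if j = 0 then \<lambda>_. 0 else \<phi>)" for j :: nat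
  have wealth: "terminal_wealth X 2 \<tau> \<psi> \<omega> = gain \<phi> S T \<omega>" for \<omega>
    by (simp add: terminal_wealth_def numeral_2_eq_2 \<tau>_def \<psi>_def)
  have "AE \<omega> in M. \<tau> j \<omega> < \<infinity>" for j
    using fin AE_space by eventually_elim (auto simp: \<tau>_def intro: le_less_trans[OF le])
  moreover have "stop_time M F (\<tau> j)" for j
    using S T by (auto simp: \<tau>_def intro: stopping_time_const)
  moreover have "\<psi> j \<in> borel_measurable (sigma_at M F (\<tau> j))" if "j < 2" for j
    using that \<phi> by (auto simp: \<tau>_def \<psi>_def)
  moreover have "\<tau> j \<omega> \<le> \<tau> (Suc j) \<omega>" if "\<omega> \<in> space M" for j \<omega>
    using le[OF that] by (simp add: \<tau>_def)
  moreover have "\<tau> 0 \<omega> = 0" for \<omega>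
    by (simp add: \<tau>_def)
  ultimately have "simple_data M F 2 \<tau> \<psi>"
    by (simp add: simple_data_def)
  moreover have "\<not> simple_arbitrage M F X (simple_process 2 \<tau> \<psi>)"
    using na by (simp add: no_arbitrage_def)
  ultimately have "measure M {\<omega> \<in> space M. 0 < gain \<phi> S T \<omega>} = 0"
    using nonneg unfolding simple_arbitrage_def wealth[symmetric]
    by (metis measure_nonneg order_le_less)
  moreover have "{\<omega> \<in> space M. 0 < gain \<phi> S T \<omega>} \<in> events"
    using gain_measurable_M[OF S T \<phi>] by measurable
  ultimately have "AE \<omega> in M. \<not> 0 < gain \<phi> S T \<omega>"
    by (simp add: prob_Collect_eq_0)
  with nonneg show ?thesis
    by eventually_elim simp
qed

text \<open>Holding \<open>H\<close> until its increment drops below zero never loses. The drop may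
  never come, so the trade is also closed at a fixed \<open>q\<close>. If the upward crossing came
  strictly first, some rational \<open>q\<close> before the drop would show a positive gain.\<close>

lemma no_arbitrage_hitting_time_le:
  assumes na: no_arbitrage
    and S: "stop_time M F S" and bdd: "\<And>\<omega>. \<omega> \<in> space M \<Longrightarrow> S \<omega> \<le> ennreal K"
    and H: "H \<in> borel_measurable (sigma_at M F S)"
  shows "AE \<omega> in M. hitting_time X S (\<lambda>\<omega>. - H \<omega>) (\<lambda>_. 0) \<omega> \<le> hitting_time X S H (\<lambda>_. 0) \<omega>"
proof -
  let ?N = "hitting_time X S (\<lambda>\<omega>. - H \<omega>) (\<lambda>_. 0)"
  \<comment> \<open>The cap at \<open>q\<close> keeps \<open>T\<close> finite, as \<open>S\<close>
    is bounded. The maximum with \<open>S\<close> matters when \<open>q\<close> comes before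
    \<open>S\<close>: then \<open>T = S\<close> and the gain is 0.\<close>
  define T where "T q \<omega> = max (S \<omega>) (min (?N \<omega>) (ennreal q))" for q \<omega>
  have N: "stop_time M F ?N"
    using S H by (intro stop_time_hitting_time) auto
  have T: "stop_time M F (T q)" for q
    unfolding T_def using S N by (intro stopping_time_max stopping_time_min stopping_time_const)
  have fin: "T q \<omega> < \<infinity>" if "\<omega> \<in> space M" for q \<omega>
    using le_less_trans[OF bdd[OF that] ennreal_less_top]
    by (simp add: T_def min_less_iff_disj)
  have nonneg: "0 \<le> gain H S (T q) \<omega>" if \<omega>: "\<omega> \<in> space M" for q \<omega>
  proof -
    have T_real: "ennreal (enn2real (T q \<omega>)) = T q \<omega>"
      using fin[OF \<omega>] by simp
    have "(- H \<omega>) \<bullet> (X (enn2real (T q \<omega>)) \<omega> - at_time X S \<omega>) \<le> 0"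
      by (rule upto_hitting_time[where H = "\<lambda>\<omega>. - H \<omega>" and c = "\<lambda>_. 0", OF \<omega>])
        (simp_all add: T_real, simp_all add: T_def hitting_time_ge)
    then show ?thesis
      by (simp add: at_time_def)
  qed
  have "AE \<omega> in M. gain H S (T q) \<omega> = 0" for q
    using fin nonneg by (intro no_arbitrage_gain_eq_0[OF na S T _ _ H]) (auto simp: T_def)
  \<comment> \<open>The rational chosen below depends on \<open>\<omega>\<close>, so the countably
    many null sets are united first.\<close>
  then have "AE \<omega> in M. \<forall>q\<in>\<rat>. gain H S (T q) \<omega> = 0"
    by (simp add: AE_ball_countable countable_rat)
  with AE_space show ?thesis
  proof eventually_elim
    case (elim \<omega>)
    show ?case
    proof (rule ccontr)
      assume "\<not> ?thesis"
      then have "hitting_time X S H (\<lambda>_. 0) \<omega> < ?N \<omega>"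
        by simp
      from hitting_time_less_ratE[OF elim(1) this] obtain q where q: "q \<in> \<rat>" "0 \<le> q" "S \<omega> \<le> ennreal q"
        "ennreal q < ?N \<omega>" "0 < H \<omega> \<bullet> (X q \<omega> - at_time X S \<omega>)" .
      then have "T q \<omega> = ennreal q"
        by (simp add: T_def)
      then have "gain H S (T q) \<omega> > 0"
        using q by (simp add: at_time_def[of X "T q"])
      with elim(2) q(1) show False
        by simp
    qed
  qed
qed

lemma no_arbitrage_imp_TWC:
  assumes na: no_arbitrage
  shows "TWC_bounded M F X"
  unfolding TWC_bounded_def crossing_time_eq_hitting_time
proof (intro allI impI)
  fix S and H :: "'a \<Rightarrow> real^'d"
  assume S: "stop_time M F S" and bdd: "\<exists>K::real. \<forall>\<omega>\<in>space M. S \<omega> \<le> ennreal K"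
    and "direction M F S H"
  then have H: "H \<in> borel_measurable (sigma_at M F S)"
    by (simp add: direction_def)
  obtain K where K: "\<And>\<omega>. \<omega> \<in> space M \<Longrightarrow> S \<omega> \<le> ennreal K"
    using bdd by blast
  have "AE \<omega> in M. hitting_time X S (\<lambda>\<omega>. - H \<omega>) (\<lambda>_. 0) \<omega> \<le> hitting_time X S H (\<lambda>_. 0) \<omega>"
    by (rule no_arbitrage_hitting_time_le[OF na S K H])
  moreover have "AE \<omega> in M. hitting_time X S H (\<lambda>_. 0) \<omega> \<le> hitting_time X S (\<lambda>\<omega>. - H \<omega>) (\<lambda>_. 0) \<omega>"
    using no_arbitrage_hitting_time_le[OF na S K, of "\<lambda>\<omega>. - H \<omega>"] H by simp
  ultimately show "AE \<omega> in M. hitting_time X S H (\<lambda>_. 0) \<omega> = hitting_time X S (\<lambda>\<omega>. - H \<omega>) (\<lambda>_. 0) \<omega>"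
    by eventually_elim simp
qed

text \<open>This makes the event in (NOA) measurable: the supremum runs over uncountably many times,
  while the right side is a countable union of conditions on hitting times. A supremum below
  \<open>\<epsilon>\<close> is at most some rational \<open>r < \<epsilon>\<close>, which means that
  the level \<open>r\<close> is never exceeded.\<close>

lemma SUP_path_less_iff:
  assumes "S \<omega> < \<infinity>"
  shows "(SUP t\<in>{enn2real (S \<omega>)..}. ereal (H \<omega> \<bullet> (X t \<omega> - at_time X S \<omega>))) < ereal \<epsilon> \<longleftrightarrow>
    (\<exists>r::rat. of_rat r < \<epsilon> \<and> hitting_time X S H (\<lambda>_. of_rat r) \<omega> = \<infinity>)" (is "?sup < _ \<longleftrightarrow> _")
proof -
  have le_iff: "S \<omega> \<le> ennreal t \<and> 0 \<le> t \<longleftrightarrow> enn2real (S \<omega>) \<le> t" for t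
    using assms by (cases "S \<omega>") (auto simp: ennreal_le_iff2)
  have infinite: "hitting_time X S H (\<lambda>_. c) \<omega> = \<infinity> \<longleftrightarrow> ?sup \<le> ereal c" for c
  proof -
    have "hitting_time X S H (\<lambda>_. c) \<omega> = \<infinity> \<longleftrightarrow>
      (\<forall>t. 0 \<le> t \<and> S \<omega> \<le> ennreal t \<longrightarrow> H \<omega> \<bullet> (X t \<omega> - at_time X S \<omega>) \<le> c)"
      unfolding hitting_time_def infinity_ennreal_def Inf_top_conv
      by (simp add: Ball_def not_less[symmetric]) (metis ennreal_neq_top)
    also have "\<dots> \<longleftrightarrow> ?sup \<le> ereal c"
      unfolding SUP_le_iff using le_iff by auto
    finally show ?thesis .
  qed
  show ?thesis
    unfolding infinite
  proof
    assume "?sup < ereal \<epsilon>"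
    from ereal_dense3[OF this] show "\<exists>r::rat. of_rat r < \<epsilon> \<and> ?sup \<le> ereal (of_rat r)"
      by (auto intro: less_imp_le)
  next
    assume "\<exists>r::rat. of_rat r < \<epsilon> \<and> ?sup \<le> ereal (of_rat r)"
    then show "?sup < ereal \<epsilon>"
      by (auto intro: le_less_trans)
  qed
qed

lemma no_arbitrage_imp_NOA:
  assumes na: no_arbitrage
  shows "NOA M F X"
  unfolding NOA_def
proof (intro allI impI)
  fix S \<epsilon> and H :: "'a \<Rightarrow> real^'d"
  assume S: "stop_time M F S" and pos: "measure M {\<omega> \<in> space M. S \<omega> < \<infinity>} > 0"
    and \<epsilon>: "(0::real) < \<epsilon>" and "direction M F S H"
  then have H: "H \<in> borel_measurable (sigma_at M F S)"
    by (simp add: direction_def)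
  note [measurable] = stop_time_measurable_M[OF S]
  let ?sup = "\<lambda>\<omega>. SUP t\<in>{enn2real (S \<omega>)..}. ereal (H \<omega> \<bullet> (X t \<omega> - at_time X S \<omega>))"
  show "measure M {\<omega> \<in> space M. S \<omega> < \<infinity> \<and> ?sup \<omega> < ereal \<epsilon>} > 0"
  proof (rule ccontr)
    assume "\<not> ?thesis"
    then have "measure M {\<omega> \<in> space M. S \<omega> < \<infinity> \<and> ?sup \<omega> < ereal \<epsilon>} = 0"
      by (simp add: not_less measure_le_0_iff)
    moreover have "{\<omega> \<in> space M. S \<omega> < \<infinity> \<and> ?sup \<omega> < ereal \<epsilon>} \<in> events"
    proof -
      have [measurable]: "hitting_time X S H (\<lambda>_. of_rat r) \<in> borel_measurable M" for r
        using S H by (intro stop_time_measurable_M stop_time_hitting_time) auto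
      have "{\<omega> \<in> space M. S \<omega> < \<infinity> \<and> ?sup \<omega> < ereal \<epsilon>} =
        {\<omega> \<in> space M. S \<omega> < \<infinity> \<and> (\<exists>r::rat. of_rat r < \<epsilon> \<and> hitting_time X S H (\<lambda>_. of_rat r) \<omega> = \<infinity>)}"
        using SUP_path_less_iff by auto
      also have "\<dots> \<in> events"
        by measurable
      finally show ?thesis .
    qed
    ultimately have AE_sup: "AE \<omega> in M. \<not> (S \<omega> < \<infinity> \<and> ?sup \<omega> < ereal \<epsilon>)"
      by (simp add: prob_Collect_eq_0)
    \<comment> \<open>A rational level fits \<open>SUP_path_less_iff\<close>: if it were never
      exceeded, the supremum would be below \<open>\<epsilon>\<close>, which a.s. does not happen on
      \<open>S < \<infinity>\<close>.\<close>
    obtain r :: rat where r: "0 < real_of_rat r" "real_of_rat r < \<epsilon>"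
      using of_rat_dense[OF \<epsilon>] by blast
    define \<delta> :: real where "\<delta> = of_rat r"
    have \<delta>: "0 < \<delta>"
      using r by (simp add: \<delta>_def)
    have AE_hit: "AE \<omega> in M. S \<omega> < \<infinity> \<longrightarrow> hitting_time X S H (\<lambda>_. \<delta>) \<omega> < \<infinity>"
      using AE_sup
      by eventually_elim (use SUP_path_less_iff r in \<open>auto simp: less_top \<delta>_def\<close>)
    \<comment> \<open>\<open>S\<close> may be unbounded or infinite, while trading times must be
      a.s. finite. So for each \<open>K\<close> the trade starts at \<open>min S K\<close>, with
      position 0 where \<open>S\<close> exceeds \<open>K\<close>.\<close>
    have "AE \<omega> in M. \<not> S \<omega> \<le> ennreal (real K)" for K :: nat
    proof -
      let ?R = "\<lambda>\<omega>. min (S \<omega>) (ennreal (real K))"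
      let ?G = "\<lambda>\<omega>. if S \<omega> \<le> ennreal (real K) then H \<omega> else 0"
      \<comment> \<open>where \<open>S > K\<close>, the level \<open>-1\<close> is exceeded at once, which keeps \<open>T\<close> finite\<close>
      let ?c = "\<lambda>\<omega>. if S \<omega> \<le> ennreal (real K) then \<delta> else - 1"
      define T where "T = hitting_time X ?R ?G ?c"
      have R: "stop_time M F ?R"
        using S by (intro stopping_time_min stopping_time_const)
      have G: "?G \<in> borel_measurable (sigma_at M F ?R)"
        by (rule measurable_truncated[OF S H]) auto
      have T: "stop_time M F T"
        unfolding T_def by (intro stop_time_hitting_time[OF R G] measurable_truncated[OF S]) auto
      have on: "at_time X ?R \<omega> = at_time X S \<omega>" "T \<omega> = hitting_time X S H (\<lambda>_. \<delta>) \<omega>"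
        if "S \<omega> \<le> ennreal (real K)" for \<omega>
        using that by (simp_all add: T_def hitting_time_def at_time_def min_absorb1)
      have fin: "AE \<omega> in M. T \<omega> < \<infinity>"
        using AE_hit
      proof eventually_elim
        case (elim \<omega>)
        show ?case
        proof (cases "S \<omega> \<le> ennreal (real K)")
          case True
          then show ?thesis
            using elim le_less_trans[OF True ennreal_less_top] on by simp
        next
          case False
          then have "T \<omega> \<le> ennreal (real K)"
            unfolding T_def by (intro hitting_time_le) auto
          from le_less_trans[OF this ennreal_less_top] show ?thesis
            by simp
        qed
      qed
      have gain_ge: "T \<omega> < \<infinity> \<Longrightarrow> ?c \<omega> \<le> gain ?G ?R T \<omega>" if "\<omega> \<in> space M" for \<omega>
        using at_hitting_time[OF that, of ?R ?G ?c] by (simp only: T_def)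
      have "AE \<omega> in M. 0 \<le> gain ?G ?R T \<omega>"
        using fin AE_space
      proof eventually_elim
        case (elim \<omega>)
        then show ?case
          using gain_ge[of \<omega>] \<delta>
          by (cases "S \<omega> \<le> ennreal (real K)") auto
      qed
      moreover have "?R \<omega> \<le> T \<omega>" for \<omega>
        unfolding T_def by (rule hitting_time_ge[of ?R])
      ultimately have "AE \<omega> in M. gain ?G ?R T \<omega> = 0"
        by (intro no_arbitrage_gain_eq_0[OF na R T _ fin G])
      \<comment> \<open>Where \<open>S \<le> K\<close> the gain is at least
        \<open>\<delta> > 0\<close>, so a gain that vanishes a.s. makes this event null.\<close>
      with fin AE_space show ?thesis
      proof eventually_elim
        case (elim \<omega>)
        then show ?case
          using gain_ge[of \<omega>] \<delta> by auto
      qed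
    qed
    then have "AE \<omega> in M. \<forall>K::nat. \<not> S \<omega> \<le> ennreal (real K)"
      by (simp add: AE_all_countable)
    then have "AE \<omega> in M. \<not> S \<omega> < \<infinity>"
    proof eventually_elim
      case (elim \<omega>)
      show ?case
      proof
        assume "S \<omega> < \<infinity>"
        then obtain K :: nat where "S \<omega> < of_nat K"
          using ennreal_Ex_less_of_nat[of "S \<omega>"] by auto
        with elim show False
          by (metis ennreal_of_nat_eq_real_of_nat less_imp_le)
      qed
    qed
    then have "measure M {\<omega> \<in> space M. S \<omega> < \<infinity>} = 0"
      by (simp add: prob_Collect_eq_0)
    with pos show False
      by simp
  qed
qed

section \<open>(TWC) and (NOA) imply no arbitrage\<close>

lemma NOA_AE_eq_infinity:
  assumes noa: "NOA M F X"
    and R: "stop_time M F R" and H: "direction M F R H" and \<delta>: "0 < \<delta>"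
    and later: "AE \<omega> in M. R \<omega> < \<infinity> \<longrightarrow> (\<exists>t. enn2real (R \<omega>) \<le> t \<and> \<delta> \<le> H \<omega> \<bullet> (X t \<omega> - at_time X R \<omega>))"
  shows "AE \<omega> in M. R \<omega> = \<infinity>"
proof -
  note [measurable] = stop_time_measurable_M[OF R]
  let ?sup = "\<lambda>\<omega>. SUP t\<in>{enn2real (R \<omega>)..}. ereal (H \<omega> \<bullet> (X t \<omega> - at_time X R \<omega>))"
  \<comment> \<open>The later time from \<open>later\<close> shows that the supremum reaches
    \<open>\<delta>\<close>, so the event in (NOA) is null. By contraposition (NOA) leaves no mass
    for \<open>R < \<infinity>\<close>.\<close>
  have "AE \<omega> in M. \<not> (R \<omega> < \<infinity> \<and> ?sup \<omega> < ereal \<delta>)"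
    using later
  proof eventually_elim
    case (elim \<omega>)
    have "ereal \<delta> \<le> ?sup \<omega>" if "R \<omega> < \<infinity>"
    proof -
      obtain t where "enn2real (R \<omega>) \<le> t" "\<delta> \<le> H \<omega> \<bullet> (X t \<omega> - at_time X R \<omega>)"
        using elim \<open>R \<omega> < \<infinity>\<close> by blast
      then show ?thesis
        by (intro SUP_upper2[of t]) auto
    qed
    then show ?case
      using leD by blast
  qed
  then have "measure M {\<omega> \<in> space M. R \<omega> < \<infinity> \<and> ?sup \<omega> < ereal \<delta>} = 0"
    by (simp add: measure_def emeasure_eq_0_AE)
  then have "measure M {\<omega> \<in> space M. R \<omega> < \<infinity>} = 0"
    using noa R H \<delta> unfolding NOA_def by (metis (no_types, lifting) less_irrefl measure_nonneg order_le_less)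
  then have "AE \<omega> in M. \<not> R \<omega> < \<infinity>"
    by (simp add: prob_Collect_eq_0)
  then show ?thesis
    by eventually_elim (simp add: not_less top_unique)
qed

text \<open>A drop to \<open>- \<delta>\<close> before \<open>T\<close> has to be made up by time
  \<open>T\<close>, where the increment is nonnegative on \<open>B\<close>. After the drop a rise by
  \<open>\<delta>\<close> would then be certain, which (NOA) permits only if the drop has
  probability zero.\<close>

lemma NOA_not_below:
  assumes noa: "NOA M F X"
    and S: "stop_time M F S" and T: "stop_time M F T"
    and H: "H \<in> borel_measurable (sigma_at M F S)" "\<And>\<omega>. norm (H \<omega>) = 1"
    and B: "Measurable.pred (sigma_at M F S) B"
    and fin: "AE \<omega> in M. T \<omega> < \<infinity>"
    and nonneg: "AE \<omega> in M. B \<omega> \<longrightarrow> 0 \<le> gain H S T \<omega>"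
    and \<delta>: "0 < \<delta>"
  shows "AE \<omega> in M. B \<omega> \<longrightarrow> T \<omega> \<le> hitting_time X S (\<lambda>\<omega>. - H \<omega>) (\<lambda>_. \<delta>) \<omega>"
proof -
  define N where "N = hitting_time X S (\<lambda>\<omega>. - H \<omega>) (\<lambda>_. \<delta>)"
  define C where "C \<omega> \<longleftrightarrow> B \<omega> \<and> N \<omega> < T \<omega>" for \<omega>
  \<comment> \<open>The value infinity off \<open>C\<close> confines (NOA) to the event
    \<open>C\<close>, where the rise is certain. \<open>C\<close> is known at \<open>N\<close>, so
    \<open>R\<close> is again a stopping time.\<close>
  define R where "R \<omega> = (if C \<omega> then N \<omega> else \<infinity>)" for \<omega>
  have N: "stop_time M F N"
    unfolding N_def using S H(1) by (intro stop_time_hitting_time) auto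
  have S_le_N: "S \<omega> \<le> N \<omega>" for \<omega>
    by (simp add: N_def hitting_time_ge)
  have C: "Measurable.pred (sigma_at M F N) C"
    unfolding C_def[abs_def]
    using sigma_at_mono[OF S N S_le_N B] ext.stopping_time_less[OF N T] by measurable
  have R: "stop_time M F R"
    unfolding stop_time_iff
  proof (intro allI impI)
    fix t :: real assume t: "0 \<le> t"
    have "{\<omega> \<in> space M. R \<omega> \<le> ennreal t} = {\<omega> \<in> space M. C \<omega> \<and> N \<omega> \<le> ennreal t}"
      by (auto simp: R_def top_unique)
    then show "{\<omega> \<in> space M. R \<omega> \<le> ennreal t} \<in> sets (F t)"
      using pred_sigma_atD[OF N C t] by (simp add: pred_def space_F[OF t])
  qed
  have "S \<omega> \<le> R \<omega>" for \<omega>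
    by (simp add: R_def S_le_N)
  from sigma_at_mono[OF S R this H(1)] have dir: "direction M F R H"
    by (simp add: direction_def H(2))
  have "AE \<omega> in M. R \<omega> < \<infinity> \<longrightarrow> (\<exists>t. enn2real (R \<omega>) \<le> t \<and> \<delta> \<le> H \<omega> \<bullet> (X t \<omega> - at_time X R \<omega>))"
    using fin nonneg AE_space
  proof eventually_elim
    case (elim \<omega>)
    show ?case
    proof (intro impI exI conjI)
      assume "R \<omega> < \<infinity>"
      then have \<omega>: "B \<omega>" "N \<omega> < T \<omega>" "R \<omega> = N \<omega>" "N \<omega> < \<infinity>"
        by (auto simp: R_def C_def split: if_splits)
      show "enn2real (R \<omega>) \<le> enn2real (T \<omega>)"
        using \<omega> elim(1) by (intro enn2real_mono) auto
      \<comment> \<open>At \<open>N\<close> the loss is at least \<open>\<delta>\<close>, and on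
        \<open>B\<close> it is recovered by \<open>T\<close>; subtracting gives the rise from
        \<open>R = N\<close> to \<open>T\<close>.\<close>
      have "\<delta> \<le> (- H \<omega>) \<bullet> (at_time X N \<omega> - at_time X S \<omega>)"
        using at_hitting_time[OF elim(3), of S "\<lambda>\<omega>. - H \<omega>" "\<lambda>_. \<delta>"] \<omega>(4) by (simp add: N_def)
      with elim(2) \<omega>(1) show "\<delta> \<le> H \<omega> \<bullet> (X (enn2real (T \<omega>)) \<omega> - at_time X R \<omega>)"
        by (simp add: at_time_def \<omega>(3) inner_diff_right)
    qed
  qed
  from NOA_AE_eq_infinity[OF noa R dir \<delta> this] show ?thesis
  proof eventually_elim
    case (elim \<omega>)
    then show ?case
      unfolding N_def[symmetric] by (auto simp: R_def C_def not_less split: if_splits)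
  qed
qed

text \<open>\<open>NOA_not_below\<close> puts \<open>T\<close> no later than the downward crossing,
  (TWC) turns this into the upward crossing, and up to that time the increment is at most 0. The
  event \<open>B\<close> marks where a trade really takes place, since \<open>H\<close> is a unit
  vector also where the position vanishes.\<close>

lemma TWC_NOA_gain_le_0:
  assumes twc: "TWC_bounded M F X" and noa: "NOA M F X"
    and S: "stop_time M F S" and T: "stop_time M F T"
    and bdd: "\<And>\<omega>. \<omega> \<in> space M \<Longrightarrow> S \<omega> \<le> ennreal K"
    and H: "H \<in> borel_measurable (sigma_at M F S)" "\<And>\<omega>. norm (H \<omega>) = 1"
    and B: "Measurable.pred (sigma_at M F S) B"
    and le: "\<And>\<omega>. \<omega> \<in> space M \<Longrightarrow> B \<omega> \<Longrightarrow> S \<omega> \<le> T \<omega>" and fin: "AE \<omega> in M. T \<omega> < \<infinity>"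
    and nonneg: "AE \<omega> in M. B \<omega> \<longrightarrow> 0 \<le> gain H S T \<omega>"
  shows "AE \<omega> in M. B \<omega> \<longrightarrow> gain H S T \<omega> \<le> 0"
proof -
  let ?N = "\<lambda>c. hitting_time X S (\<lambda>\<omega>. - H \<omega>) (\<lambda>_. c)"
  \<comment> \<open>The levels shrink to 0, so a strictly negative increment before \<open>T\<close>
    would pass one of them.\<close>
  have "AE \<omega> in M. \<forall>n. B \<omega> \<longrightarrow> T \<omega> \<le> ?N (inverse (real (Suc n))) \<omega>"
    unfolding AE_all_countable
    by (intro allI NOA_not_below[OF noa S T H B fin nonneg]) simp
  moreover have "AE \<omega> in M. hitting_time X S H (\<lambda>_. 0) \<omega> = ?N 0 \<omega>"
  proof -
    have "direction M F S H"
      using H by (simp add: direction_def)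
    moreover have "\<exists>K::real. \<forall>\<omega>\<in>space M. S \<omega> \<le> ennreal K"
      using bdd by blast
    ultimately show ?thesis
      using twc S unfolding TWC_bounded_def crossing_time_eq_hitting_time by blast
  qed
  ultimately show ?thesis
    using fin AE_space
  proof eventually_elim
    case (elim \<omega>)
    show ?case
    proof
      assume "B \<omega>"
      have "T \<omega> \<le> ?N 0 \<omega>"
      proof (rule ccontr)
        assume "\<not> ?thesis"
        then have "?N 0 \<omega> < T \<omega>"
          by simp
        then obtain t where t: "0 \<le> t" "S \<omega> \<le> ennreal t" "ennreal t < T \<omega>"
          "0 < (- H \<omega>) \<bullet> (X t \<omega> - at_time X S \<omega>)"
          by (rule hitting_time_lessE)
        then obtain n where n: "inverse (real (Suc n)) < (- H \<omega>) \<bullet> (X t \<omega> - at_time X S \<omega>)"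
          using reals_Archimedean by blast
        have "(- H \<omega>) \<bullet> (X t \<omega> - at_time X S \<omega>) \<le> inverse (real (Suc n))"
          using elim(1) \<open>B \<omega>\<close> t
          by (intro before_hitting_time[where H = "\<lambda>\<omega>. - H \<omega>" and c = "\<lambda>_. inverse (real (Suc n))"])
            (auto intro: less_le_trans)
        with n show False
          by simp
      qed
      then have T_le: "T \<omega> \<le> hitting_time X S H (\<lambda>_. 0) \<omega>"
        by (simp add: elim(2))
      have T_real: "ennreal (enn2real (T \<omega>)) = T \<omega>"
        using elim(3) by simp
      have "H \<omega> \<bullet> (X (enn2real (T \<omega>)) \<omega> - at_time X S \<omega>) \<le> 0"
        by (rule upto_hitting_time[where c = "\<lambda>_. 0", OF elim(4)])
          (use T_le le[OF elim(4) \<open>B \<omega>\<close>] in \<open>auto simp: T_real\<close>)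
      then show "gain H S T \<omega> \<le> 0"
        by (simp add: at_time_def)
    qed
  qed
qed

text \<open>Reduction to unit directions and bounded times. Dividing by the norm of a nonzero
  position keeps the sign of the gain. \<open>S\<close> is capped at \<open>K\<close> for (TWC), and
  each finite value of \<open>S\<close> lies below some \<open>K\<close>.\<close>

lemma TWC_NOA_gain_eq_0:
  assumes twc: "TWC_bounded M F X" and noa: "NOA M F X"
    and S: "stop_time M F S" and T: "stop_time M F T"
    and le: "\<And>\<omega>. \<omega> \<in> space M \<Longrightarrow> S \<omega> \<le> T \<omega>" and fin: "AE \<omega> in M. T \<omega> < \<infinity>"
    and \<phi>: "\<phi> \<in> borel_measurable (sigma_at M F S)"
    and nonneg: "AE \<omega> in M. 0 \<le> gain \<phi> S T \<omega>"
  shows "AE \<omega> in M. gain \<phi> S T \<omega> = 0"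
proof -
  note [measurable] = \<phi>
  \<comment> \<open>This vector stands in for the direction where \<open>\<phi>\<close> vanishes or
    \<open>S\<close> exceeds \<open>K\<close>, so that \<open>H\<close> has norm 1 everywhere;
    \<open>B\<close> leaves these points out.\<close>
  obtain e :: "real^'d" where e: "norm e = 1"
    using vector_choose_size[of 1] by auto
  have "AE \<omega> in M. S \<omega> \<le> ennreal (real K) \<longrightarrow> gain \<phi> S T \<omega> \<le> 0" for K :: nat
  proof -
    define R where "R \<omega> = min (S \<omega>) (ennreal (real K))" for \<omega>
    define H where "H \<omega> = (if S \<omega> \<le> ennreal (real K) then if \<phi> \<omega> = 0 then e else sgn (\<phi> \<omega>) else e)" for \<omega>
    define B where "B \<omega> \<longleftrightarrow> (if S \<omega> \<le> ennreal (real K) then \<phi> \<omega> \<noteq> 0 else False)" for \<omega>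
    have R: "stop_time M F R"
      unfolding R_def using S by (intro stopping_time_min stopping_time_const)
    have H: "H \<in> borel_measurable (sigma_at M F R)"
      unfolding H_def[abs_def] R_def[abs_def] sgn_div_norm
      by (intro measurable_truncated[OF S]) auto
    have norm_H: "norm (H \<omega>) = 1" for \<omega>
      by (simp add: H_def e norm_sgn)
    have B: "Measurable.pred (sigma_at M F R) B"
      unfolding B_def[abs_def] R_def[abs_def] by (intro measurable_truncated[OF S]) auto
    have gain_eq: "gain \<phi> S T \<omega> = norm (\<phi> \<omega>) * gain H R T \<omega>" if "B \<omega>" for \<omega>
      using that by (auto simp: B_def H_def R_def at_time_def min_absorb1 sgn_div_norm split: if_splits)
    have \<phi>_pos: "0 < norm (\<phi> \<omega>)" if "B \<omega>" for \<omega>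
      using that by (auto simp: B_def split: if_splits)
    have "AE \<omega> in M. B \<omega> \<longrightarrow> gain H R T \<omega> \<le> 0"
    proof (rule TWC_NOA_gain_le_0[OF twc noa R T _ H norm_H B _ fin])
      show "R \<omega> \<le> ennreal (real K)" for \<omega>
        by (simp add: R_def)
      show "R \<omega> \<le> T \<omega>" if "\<omega> \<in> space M" for \<omega>
        using le[OF that] by (simp add: R_def min.coboundedI1)
      show "AE \<omega> in M. B \<omega> \<longrightarrow> 0 \<le> gain H R T \<omega>"
        using nonneg
      proof eventually_elim
        case (elim \<omega>)
        show ?case
        proof
          assume "B \<omega>"
          with elim show "0 \<le> gain H R T \<omega>"
            using \<phi>_pos[of \<omega>] by (auto simp: gain_eq zero_le_mult_iff)
        qed
      qed
    qed
    then show ?thesis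
    proof eventually_elim
      case (elim \<omega>)
      show ?case
      proof
        assume "S \<omega> \<le> ennreal (real K)"
        then consider "\<phi> \<omega> = 0" | "B \<omega>"
          by (auto simp: B_def)
        then show "gain \<phi> S T \<omega> \<le> 0"
        proof cases
          case 2
          with elim show ?thesis
            unfolding gain_eq[OF 2] by (intro mult_nonneg_nonpos) auto
        qed simp
      qed
    qed
  qed
  then have "AE \<omega> in M. \<forall>K::nat. S \<omega> \<le> ennreal (real K) \<longrightarrow> gain \<phi> S T \<omega> \<le> 0"
    unfolding AE_all_countable by blast
  with nonneg fin AE_space show ?thesis
  proof eventually_elim
    case (elim \<omega>)
    obtain K :: nat where "S \<omega> < of_nat K"
      using ennreal_Ex_less_of_nat[of "S \<omega>"] le_less_trans[OF le[OF elim(3)] elim(2)] by auto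
    with elim(1,4) show ?case
      by (metis antisym ennreal_of_nat_eq_real_of_nat less_imp_le)
  qed
qed

text \<open>With this, the sign of the wealth so far may decide whether the next trade is
  made.\<close>

lemma measurable_terminal_wealth:
  assumes \<tau>: "\<And>j. j \<le> n \<Longrightarrow> stop_time M F (\<tau> j)"
    and le: "\<And>\<omega> j. \<omega> \<in> space M \<Longrightarrow> j < n \<Longrightarrow> \<tau> j \<omega> \<le> \<tau> (Suc j) \<omega>"
    and \<phi>: "\<And>j. j < n \<Longrightarrow> \<phi> j \<in> borel_measurable (sigma_at M F (\<tau> j))"
  shows "terminal_wealth X n \<tau> \<phi> \<in> borel_measurable (sigma_at M F (\<tau> n))"
  using assms
proof (induction n)
  case (Suc n)
  have \<tau>: "stop_time M F (\<tau> n)" "stop_time M F (\<tau> (Suc n))"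
    using Suc.prems(1) by auto
  note mono = sigma_at_mono[OF \<tau> Suc.prems(2)]
  have [measurable]: "terminal_wealth X n \<tau> \<phi> \<in> borel_measurable (sigma_at M F (\<tau> (Suc n)))"
    "\<phi> n \<in> borel_measurable (sigma_at M F (\<tau> (Suc n)))"
    "at_time X (\<tau> n) \<in> borel_measurable (sigma_at M F (\<tau> (Suc n)))"
    "at_time X (\<tau> (Suc n)) \<in> borel_measurable (sigma_at M F (\<tau> (Suc n)))"
    using Suc.prems by (auto intro!: mono Suc.IH measurable_at_time)
  have "terminal_wealth X (Suc n) \<tau> \<phi> = (\<lambda>\<omega>. terminal_wealth X n \<tau> \<phi> \<omega> + gain (\<phi> n) (\<tau> n) (\<tau> (Suc n)) \<omega>)"
    by (simp add: terminal_wealth_def fun_eq_iff)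
  also have "\<dots> \<in> borel_measurable (sigma_at M F (\<tau> (Suc n)))"
    by measurable
  finally show ?case .
qed (simp add: terminal_wealth_def[abs_def])

text \<open>Induction that splits off the last trade. Where the wealth before it is negative, this
  trade must gain; made only there, it is lossless, so by the one-trade case that event is null.
  Hence the earlier wealth is nonnegative, vanishes by induction, and the last trade is itself
  lossless.\<close>

lemma TWC_NOA_terminal_wealth_eq_0:
  assumes twc: "TWC_bounded M F X" and noa: "NOA M F X"
    and \<tau>: "\<And>j. j \<le> n \<Longrightarrow> stop_time M F (\<tau> j)" and fin: "\<And>j. j \<le> n \<Longrightarrow> AE \<omega> in M. \<tau> j \<omega> < \<infinity>"
    and le: "\<And>\<omega> j. \<omega> \<in> space M \<Longrightarrow> j < n \<Longrightarrow> \<tau> j \<omega> \<le> \<tau> (Suc j) \<omega>"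
    and \<phi>: "\<And>j. j < n \<Longrightarrow> \<phi> j \<in> borel_measurable (sigma_at M F (\<tau> j))"
    and "AE \<omega> in M. 0 \<le> terminal_wealth X n \<tau> \<phi> \<omega>"
  shows "AE \<omega> in M. terminal_wealth X n \<tau> \<phi> \<omega> = 0"
  using \<tau> fin le \<phi> assms(7)
proof (induction n)
  case (Suc n)
  let ?V = "terminal_wealth X n \<tau> \<phi>" and ?S = "\<tau> n" and ?T = "\<tau> (Suc n)"
  have V_Suc: "terminal_wealth X (Suc n) \<tau> \<phi> \<omega> = ?V \<omega> + gain (\<phi> n) ?S ?T \<omega>" for \<omega>
    by (simp add: terminal_wealth_def)
  have \<phi> [measurable]: "\<phi> n \<in> borel_measurable (sigma_at M F ?S)"
    using Suc.prems by simp
  have [measurable]: "?V \<in> borel_measurable (sigma_at M F ?S)"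
    using Suc.prems by (intro measurable_terminal_wealth) auto
  have gain_0: "AE \<omega> in M. gain \<psi> ?S ?T \<omega> = 0"
    if "\<psi> \<in> borel_measurable (sigma_at M F ?S)" "AE \<omega> in M. 0 \<le> gain \<psi> ?S ?T \<omega>" for \<psi>
    using Suc.prems that by (intro TWC_NOA_gain_eq_0[OF twc noa]) auto
  \<comment> \<open>Off \<open>?V < 0\<close> this position is zero, and on that event its gain is
    a.s. at least \<open>- ?V > 0\<close>.\<close>
  have "AE \<omega> in M. gain (\<lambda>\<omega>. if ?V \<omega> < 0 then \<phi> n \<omega> else 0) ?S ?T \<omega> = 0"
  proof (rule gain_0)
    show "(\<lambda>\<omega>. if ?V \<omega> < 0 then \<phi> n \<omega> else 0) \<in> borel_measurable (sigma_at M F ?S)"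
      by measurable
    show "AE \<omega> in M. 0 \<le> gain (\<lambda>\<omega>. if ?V \<omega> < 0 then \<phi> n \<omega> else 0) ?S ?T \<omega>"
      using Suc.prems(5) by eventually_elim (auto simp: V_Suc)
  qed
  with Suc.prems(5) have "AE \<omega> in M. 0 \<le> ?V \<omega>"
  proof eventually_elim
    case (elim \<omega>)
    then show ?case
      by (cases "?V \<omega> < 0") (auto simp: V_Suc)
  qed
  then have V_0: "AE \<omega> in M. ?V \<omega> = 0"
    using Suc.prems by (intro Suc.IH) auto
  with Suc.prems(5) have "AE \<omega> in M. 0 \<le> gain (\<phi> n) ?S ?T \<omega>"
    by eventually_elim (simp add: V_Suc)
  from gain_0[OF \<phi> this] V_0 show ?case
    by eventually_elim (simp add: V_Suc)
qed (simp add: terminal_wealth_def)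

lemma TWC_NOA_imp_no_arbitrage:
  assumes "TWC_bounded M F X" "NOA M F X"
  shows no_arbitrage
  unfolding no_arbitrage_def
proof (intro allI notI)
  fix \<Phi> assume "simple_arbitrage M F X \<Phi>"
  then obtain n \<tau> \<phi> where *: "simple_data M F n \<tau> \<phi>"
    "AE \<omega> in M. terminal_wealth X n \<tau> \<phi> \<omega> \<ge> 0"
    "measure M {\<omega> \<in> space M. terminal_wealth X n \<tau> \<phi> \<omega> > 0} > 0"
    unfolding simple_arbitrage_def by blast
  have "AE \<omega> in M. terminal_wealth X n \<tau> \<phi> \<omega> = 0"
    using *(1,2) by (intro TWC_NOA_terminal_wealth_eq_0[OF assms]) (auto simp: simple_data_def)
  then have "AE \<omega> in M. \<not> 0 < terminal_wealth X n \<tau> \<phi> \<omega>"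
    by eventually_elim simp
  with *(3) show False
    by (simp add: measure_def emeasure_eq_0_AE)
qed

end

theorem theorem3p4:
  fixes M :: "'a measure" and F :: "real \<Rightarrow> 'a measure"
    and X :: "real \<Rightarrow> 'a \<Rightarrow> real ^ 'd"
  assumes "usual_filtered_prob_space M F"
    and "adapted F X"
    and "continuous_paths M X"
  shows "(\<not> (\<exists>\<Phi>. simple_arbitrage M F X \<Phi>)) \<longleftrightarrow> (TWC_bounded M F X \<and> NOA M F X)"
proof -
  interpret continuous_market M F X
    using assms by (simp add: continuous_market_def continuous_market_axioms_def)
  have "no_arbitrage \<longleftrightarrow> TWC_bounded M F X \<and> NOA M F X"
    using no_arbitrage_imp_TWC no_arbitrage_imp_NOA TWC_NOA_imp_no_arbitrage by blast
  then show ?thesis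
    by (simp add: no_arbitrage_def)
qed

end
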